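(* Let $2 \leq k < n \leq n' < \omega$. Then $T_{n', k}$ admits $\Delta_{n, k}$.
   Context: For $2\le k<n<\omega$, $T_{n,k}$ is the theory of the random $k$-ary $n$-clique-free hypergraph, i.e. of the Fraïssé limit of the class of finite $k$-uniform hypergraphs (with edge relation $R$, symmetric and irreflexive $k$-ary) containing no set of $n$ vertices all of whose $k$-subsets are edges. A pattern on $I$ is a subset-closed $\Delta\subseteq[I]^{<\aleph_0}$. For $S\subseteq[I]^k$ and $n>k$, $\Delta_{n,k}(S)$ is the pattern on $[I]^{k-1}$ consisting of all finite $s\subseteq[I]^{k-1}$ such that there is no $v\in[I]^{n-1}$ with $[v]^{k-1}\subseteq s$ and $[v]^k\subseteq S$. $\Delta_{n,k}:=\Delta_{n,k}(S_k)$, where $S_k\subseteq[\omega]^k$ is a random $k$-ary hypergraph on $\omega$ (up to equivalence of patterns this is independent of the choice). A formula $\varphi(\bar x,\bar y)$ of $T$ admits a pattern $\Delta$ on $J$ if there are $(\bar a_j:j\in J)$ in the monster model with: for every finite $s\subseteq J$, $\exists\bar x\bigwedge_{j\in s}\varphi(\bar x,\bar a_j)$ holds iff $s\in\Delta$; $T$ admits $\Delta$ if some formula of $T$ does. *)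

theory Defs
  imports "HOL-Library.Ramsey" "HOL-Library.Multiset"
begin

unbundle cardinal_syntax

section \<open>Structures in the language of one \<open>k\<close>-ary relation symbol\<close>

record 'a struct =
  univ :: "'a set"
  rel :: "'a list set"

definition is_struct :: "nat \<Rightarrow> 'a struct \<Rightarrow> bool" where
  "is_struct k M \<longleftrightarrow> (\<forall>xs \<in> rel M. length xs = k \<and> set xs \<subseteq> univ M)"

definition embedding :: "('a \<Rightarrow> 'b) \<Rightarrow> 'a struct \<Rightarrow> 'b struct \<Rightarrow> bool" where
  "embedding f A M \<longleftrightarrow> inj_on f (univ A) \<and> f ` univ A \<subseteq> univ M \<and>
     (\<forall>xs. set xs \<subseteq> univ A \<longrightarrow> (xs \<in> rel A \<longleftrightarrow> map f xs \<in> rel M))"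

definition automorphism :: "('a \<Rightarrow> 'a) \<Rightarrow> 'a struct \<Rightarrow> bool" where
  "automorphism f M \<longleftrightarrow> embedding f M M \<and> f ` univ M = univ M"

definition substruct :: "'a struct \<Rightarrow> 'a set \<Rightarrow> 'a struct" where
  "substruct M A = \<lparr>univ = A, rel = {xs \<in> rel M. set xs \<subseteq> A}\<rparr>"

section \<open>First-order logic\<close>

text \<open>Variables are named by natural numbers. An atom \<open>Rel is\<close> is only meaningful when \<open>is\<close> has
  the arity of the relation symbol, which \<open>is_formula\<close> enforces.\<close>

datatype fm = Eq nat nat | Rel "nat list" | Neg fm | Conj fm fm | Ex nat fm

primrec is_formula :: "nat \<Rightarrow> fm \<Rightarrow> bool" where
  "is_formula k (Eq i j) \<longleftrightarrow> True"
| "is_formula k (Rel is) \<longleftrightarrow> length is = k"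
| "is_formula k (Neg \<phi>) \<longleftrightarrow> is_formula k \<phi>"
| "is_formula k (Conj \<phi> \<psi>) \<longleftrightarrow> is_formula k \<phi> \<and> is_formula k \<psi>"
| "is_formula k (Ex i \<phi>) \<longleftrightarrow> is_formula k \<phi>"

primrec fv :: "fm \<Rightarrow> nat set" where
  "fv (Eq i j) = {i, j}"
| "fv (Rel is) = set is"
| "fv (Neg \<phi>) = fv \<phi>"
| "fv (Conj \<phi> \<psi>) = fv \<phi> \<union> fv \<psi>"
| "fv (Ex i \<phi>) = fv \<phi> - {i}"

primrec sat :: "'a struct \<Rightarrow> (nat \<Rightarrow> 'a) \<Rightarrow> fm \<Rightarrow> bool" where
  "sat M e (Eq i j) \<longleftrightarrow> e i = e j"
| "sat M e (Rel is) \<longleftrightarrow> map e is \<in> rel M"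
| "sat M e (Neg \<phi>) \<longleftrightarrow> \<not> sat M e \<phi>"
| "sat M e (Conj \<phi> \<psi>) \<longleftrightarrow> sat M e \<phi> \<and> sat M e \<psi>"
| "sat M e (Ex i \<phi>) \<longleftrightarrow> (\<exists>c \<in> univ M. sat M (e(i := c)) \<phi>)"

definition is_sentence :: "nat \<Rightarrow> fm \<Rightarrow> bool" where
  "is_sentence k \<phi> \<longleftrightarrow> is_formula k \<phi> \<and> fv \<phi> = {}"

definition is_model :: "nat \<Rightarrow> fm set \<Rightarrow> 'a struct \<Rightarrow> bool" where
  "is_model k T M \<longleftrightarrow> is_struct k M \<and> univ M \<noteq> {} \<and> (\<forall>\<sigma> \<in> T. \<forall>e. sat M e \<sigma>)"

section \<open>Fraisse limits\<close>

text \<open>Every finite structure has a copy with universe in \<open>nat\<close>, so an age is represented by a set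
  of structures on sets of natural numbers.\<close>

definition age :: "nat \<Rightarrow> 'a struct \<Rightarrow> nat struct set" where
  "age k M = {A. is_struct k A \<and> finite (univ A) \<and> (\<exists>f. embedding f A M)}"

definition ultrahomogeneous :: "'a struct \<Rightarrow> bool" where
  "ultrahomogeneous M \<longleftrightarrow>
     (\<forall>A f. finite A \<and> A \<subseteq> univ M \<and> embedding f (substruct M A) M \<longrightarrow>
        (\<exists>g. automorphism g M \<and> (\<forall>x \<in> A. g x = f x)))"

definition fraisse_limit :: "nat \<Rightarrow> nat struct set \<Rightarrow> nat struct \<Rightarrow> bool" where
  "fraisse_limit k K M \<longleftrightarrow> is_struct k M \<and> age k M = K \<and> ultrahomogeneous M"

section \<open>Hypergraphs\<close>

text \<open>Hypergraphs are structures whose relation is irreflexive (it holds of tuples of distinct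
  elements only) and symmetric; its edges are the underlying sets of the tuples.\<close>

definition hypergraph :: "nat \<Rightarrow> 'a struct \<Rightarrow> bool" where
  "hypergraph k M \<longleftrightarrow> is_struct k M \<and> (\<forall>xs \<in> rel M. distinct xs) \<and>
     (\<forall>xs \<in> rel M. \<forall>ys. mset ys = mset xs \<longrightarrow> ys \<in> rel M)"

definition edges :: "'a struct \<Rightarrow> 'a set set" where
  "edges M = set ` rel M"

definition clique_free :: "nat \<Rightarrow> nat \<Rightarrow> 'a struct \<Rightarrow> bool" where
  "clique_free n k M \<longleftrightarrow> \<not> (\<exists>v \<in> nsets (univ M) n. nsets v k \<subseteq> edges M)"

definition fin_hypergraphs :: "nat \<Rightarrow> nat struct set" where
  "fin_hypergraphs k = {A. hypergraph k A \<and> finite (univ A)}"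

definition fin_clique_free_hypergraphs :: "nat \<Rightarrow> nat \<Rightarrow> nat struct set" where
  "fin_clique_free_hypergraphs n k = {A \<in> fin_hypergraphs k. clique_free n k A}"

text \<open>The theory \<open>T\<^sub>n\<^sub>,\<^sub>k\<close>. The Fraisse limit is unique up to isomorphism, so quantifying over all
  its copies is the same as fixing one.\<close>

definition T_clique_free :: "nat \<Rightarrow> nat \<Rightarrow> fm set" where
  "T_clique_free n k = {\<sigma>. is_sentence k \<sigma> \<and>
     (\<forall>F. fraisse_limit k (fin_clique_free_hypergraphs n k) F \<longrightarrow> (\<forall>e. sat F e \<sigma>))}"

definition struct_of_edges :: "nat \<Rightarrow> 'a set \<Rightarrow> 'a set set \<Rightarrow> 'a struct" where
  "struct_of_edges k V S = \<lparr>univ = V, rel = {xs. length xs = k \<and> distinct xs \<and> set xs \<subseteq> V \<and> set xs \<in> S}\<rparr>"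

definition random_hypergraph :: "nat \<Rightarrow> nat set set \<Rightarrow> bool" where
  "random_hypergraph k S \<longleftrightarrow> S \<subseteq> nsets UNIV k \<and>
     fraisse_limit k (fin_hypergraphs k) (struct_of_edges k UNIV S)"

section \<open>Monster models\<close>

text \<open>Formulas with parameters from \<open>A\<close> are pairs of a formula, with object variable \<open>0\<close>, and an
  assignment sending its other free variables into \<open>A\<close>.\<close>

definition saturated :: "nat \<Rightarrow> 'c rel \<Rightarrow> 'a struct \<Rightarrow> bool" where
  "saturated k \<kappa> M \<longleftrightarrow>
     (\<forall>A p. A \<subseteq> univ M \<and> |A| <o \<kappa> \<and>
        (\<forall>(\<phi>, e) \<in> p. is_formula k \<phi> \<and> e ` (fv \<phi> - {0}) \<subseteq> A) \<and>
        (\<forall>q. finite q \<and> q \<subseteq> p \<longrightarrow> (\<exists>c \<in> univ M. \<forall>(\<phi>, e) \<in> q. sat M (e(0 := c)) \<phi>)) \<longrightarrow>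
        (\<exists>c \<in> univ M. \<forall>(\<phi>, e) \<in> p. sat M (e(0 := c)) \<phi>))"

definition partial_elementary :: "nat \<Rightarrow> 'a struct \<Rightarrow> 'a set \<Rightarrow> ('a \<Rightarrow> 'a) \<Rightarrow> bool" where
  "partial_elementary k M A f \<longleftrightarrow> A \<subseteq> univ M \<and> f ` A \<subseteq> univ M \<and>
     (\<forall>\<phi> e. is_formula k \<phi> \<and> range e \<subseteq> A \<longrightarrow> (sat M e \<phi> \<longleftrightarrow> sat M (f \<circ> e) \<phi>))"

definition strongly_homogeneous :: "nat \<Rightarrow> 'c rel \<Rightarrow> 'a struct \<Rightarrow> bool" where
  "strongly_homogeneous k \<kappa> M \<longleftrightarrow>
     (\<forall>A f. |A| <o \<kappa> \<and> partial_elementary k M A f \<longrightarrow>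
        (\<exists>g. automorphism g M \<and> (\<forall>x \<in> A. g x = f x)))"

text \<open>"Small" means of cardinality less than \<open>\<kappa>\<close>. The monster model has to be large relative to the
  sets considered; here the language and all index sets are countable, so \<open>\<kappa>\<close> is any uncountable
  cardinal.\<close>

definition monster_model :: "nat \<Rightarrow> fm set \<Rightarrow> 'c rel \<Rightarrow> 'a struct \<Rightarrow> bool" where
  "monster_model k T \<kappa> M \<longleftrightarrow> Card_order \<kappa> \<and> natLeq <o \<kappa> \<and> is_model k T M \<and>
     saturated k \<kappa> M \<and> strongly_homogeneous k \<kappa> M"

section \<open>Patterns\<close>

definition is_pattern :: "'i set \<Rightarrow> 'i set set \<Rightarrow> bool" where
  "is_pattern I \<Delta> \<longleftrightarrow> \<Delta> \<subseteq> Fpow I \<and> (\<forall>s \<in> \<Delta>. \<forall>t \<subseteq> s. t \<in> \<Delta>)"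

definition Delta :: "'i set \<Rightarrow> nat \<Rightarrow> nat \<Rightarrow> 'i set set \<Rightarrow> 'i set set set" where
  "Delta I n k S = {s \<in> Fpow (nsets I (k - 1)).
     \<not> (\<exists>v \<in> nsets I (n - 1). nsets v (k - 1) \<subseteq> s \<and> nsets v k \<subseteq> S)}"

lemma is_pattern_Delta: "is_pattern (nsets I (k - 1)) (Delta I n k S)"
  unfolding is_pattern_def Delta_def Fpow_def
  by (auto intro: finite_subset)

text \<open>In \<open>\<phi>(x, y)\<close> the tuple \<open>x\<close> consists of the variables \<open>0, \<dots>, p - 1\<close> and the tuple \<open>y\<close> of
  the variables \<open>p, \<dots>, p + q - 1\<close>.\<close>

definition formula_admits ::
  "nat \<Rightarrow> 'a struct \<Rightarrow> fm \<Rightarrow> nat \<Rightarrow> nat \<Rightarrow> 'j set \<Rightarrow> 'j set set \<Rightarrow> bool" where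
  "formula_admits k M \<phi> p q J \<Delta> \<longleftrightarrow>
     is_formula k \<phi> \<and> fv \<phi> \<subseteq> {..<p + q} \<and>
     (\<exists>a :: 'j \<Rightarrow> 'a list.
        (\<forall>j \<in> J. length (a j) = q \<and> set (a j) \<subseteq> univ M) \<and>
        (\<forall>s \<in> Fpow J.
           (\<exists>b. length b = p \<and> set b \<subseteq> univ M \<and> (\<forall>j \<in> s. sat M (\<lambda>i. (b @ a j) ! i) \<phi>))
             \<longleftrightarrow> s \<in> \<Delta>))"

text \<open>\<open>M\<close> is meant to be the monster model of the theory in question.\<close>

definition admits :: "nat \<Rightarrow> 'a struct \<Rightarrow> 'j set \<Rightarrow> 'j set set \<Rightarrow> bool" where
  "admits k M J \<Delta> \<longleftrightarrow> (\<exists>\<phi> p q. formula_admits k M \<phi> p q J \<Delta>)"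

end

theory Submission
  imports Defs "HOL-Library.Countable"
begin

text \<open>Let \<open>G\<close> be the \<open>k\<close>-uniform hypergraph on pairs (vertex, colour), with colours below \<open>n' - 1\<close>,
  in which a \<open>k\<close>-set is an edge iff its colours are distinct and, if all of them are below \<open>n - 1\<close>,
  its set of vertices lies in \<open>S\<close>. It is \<open>(n' - 1)\<close>-partite, hence \<open>n'\<close>-clique-free, although \<open>S\<close>
  is not. To a \<open>(k - 1)\<close>-set \<open>j\<close> attach the parameters \<open>V j\<close> consisting of the pairs in
  \<open>j \<times> {..<n - 1}\<close> and the common pairs \<open>(0, c)\<close>, \<open>n - 1 \<le> c < n' - 1\<close>, which raise the clique number
  from \<open>n\<close> to \<open>n'\<close>; the formula says that \<open>x\<close> forms an edge with every \<open>(k - 1)\<close>-subset of the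
  parameters. A vertex satisfying the instances \<open>j \<in> s\<close> completes an \<open>n'\<close>-clique exactly when \<open>s\<close>
  contains all \<open>(k - 1)\<close>-subsets of some \<open>(n - 1)\<close>-clique of \<open>S\<close>.

  Saturation of the monster model is not needed: the one-point extension property over finite sets
  is first order, so it passes from the Fraisse limits to \<open>M\<close>, and it suffices to embed the countable
  hypergraph \<open>G\<close> vertex by vertex and to realise each finite set of instances.\<close>

section \<open>Universal sentences\<close>

primrec alls :: "nat list \<Rightarrow> fm \<Rightarrow> fm" where
  "alls [] \<phi> = \<phi>"
| "alls (i # is) \<phi> = Neg (Ex i (Neg (alls is \<phi>)))"

lemma is_formula_alls [simp]: "is_formula k (alls is \<phi>) \<longleftrightarrow> is_formula k \<phi>"
  by (induction "is") auto

lemma fv_alls [simp]: "fv (alls is \<phi>) = fv \<phi> - set is"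
  by (induction "is") auto

text \<open>The second hypothesis is shaped for the induction: stripping a quantifier moves its
  variable into the part of \<open>I\<close> whose values are already known to lie in the
  universe.\<close>

lemma sat_allsI:
  assumes "\<And>e'. \<forall>i \<in> I. e' i \<in> univ M \<Longrightarrow> sat M e' \<phi>"
    and "\<forall>i \<in> I - set is. e i \<in> univ M"
  shows "sat M e (alls is \<phi>)"
  using assms(2)
proof (induction "is" arbitrary: e)
  case Nil
  then show ?case using assms(1) by simp
next
  case (Cons i "is")
  have "sat M (e(i := c)) (alls is \<phi>)" if "c \<in> univ M" for c
    using Cons.prems that by (intro Cons.IH) auto
  then show ?case by auto
qed

lemma sat_allsD:
  assumes "sat M e (alls is \<phi>)" and "\<forall>i \<in> set is. e i \<in> univ M"
  shows "sat M e \<phi>"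
  using assms
proof (induction "is")
  case (Cons i "is")
  \<comment> \<open>Instantiating the quantifier with the current value of \<open>i\<close> leaves
    the assignment unchanged.\<close>
  then have "sat M (e(i := e i)) (alls is \<phi>)"
    unfolding alls.simps sat.simps by (metis list.set_intros(1))
  with Cons show ?case by simp
qed simp

text \<open>The universal closure of \<open>\<phi>\<close> over \<open>I\<close> is a sentence true
  in all the limits, so it belongs to the theory and holds in \<open>M\<close>. All first-order
  information about \<open>M\<close> is obtained in this way.\<close>

lemma T_clique_free_transfer:
  assumes M: "is_model k (T_clique_free n k) M" and \<phi>: "is_formula k \<phi>"
    and I: "finite I" "fv \<phi> \<subseteq> I"
    and F: "\<And>F e. fraisse_limit k (fin_clique_free_hypergraphs n k) F \<Longrightarrow>
      \<forall>i \<in> I. e i \<in> univ F \<Longrightarrow> sat F e \<phi>"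
    and e: "\<forall>i \<in> I. e i \<in> univ M"
  shows "sat M e \<phi>"
proof -
  obtain "is" where "is": "set is = I" using finite_list[OF I(1)] by blast
  have "alls is \<phi> \<in> T_clique_free n k"
    unfolding T_clique_free_def is_sentence_def using \<phi> I(2) "is" F
    by (auto intro!: sat_allsI[where I = I])
  then have "sat M e (alls is \<phi>)" using M unfolding is_model_def by blast
  then show ?thesis using sat_allsD e "is" by blast
qed

section \<open>Formulas expressing properties of hypergraphs\<close>

text \<open>The empty conjunction is a closed tautology, so it contributes no free variable and
  \<open>fv\<close> of a conjunction is exactly a union.\<close>

primrec conjs :: "fm list \<Rightarrow> fm" where
  "conjs [] = Neg (Ex 0 (Neg (Eq 0 0)))"
| "conjs (\<phi> # \<phi>s) = Conj \<phi> (conjs \<phi>s)"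

definition big_conj :: "'b set \<Rightarrow> ('b \<Rightarrow> fm) \<Rightarrow> fm" where
  "big_conj A f = conjs (map f (SOME xs. set xs = A))"

lemma set_some_list: "finite A \<Longrightarrow> set (SOME xs. set xs = A) = A"
  by (rule someI_ex) (rule finite_list)

lemma conjs_simps:
  "is_formula k (conjs \<phi>s) \<longleftrightarrow> (\<forall>\<phi> \<in> set \<phi>s. is_formula k \<phi>)"
  "fv (conjs \<phi>s) = (\<Union>\<phi> \<in> set \<phi>s. fv \<phi>)"
  "sat M e (conjs \<phi>s) \<longleftrightarrow> (\<forall>\<phi> \<in> set \<phi>s. sat M e \<phi>)"
  by (induction \<phi>s) auto

lemma big_conj_simps [simp]:
  assumes "finite A"
  shows "is_formula k (big_conj A f) \<longleftrightarrow> (\<forall>x \<in> A. is_formula k (f x))"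
    and "fv (big_conj A f) = (\<Union>x \<in> A. fv (f x))"
    and "sat M e (big_conj A f) \<longleftrightarrow> (\<forall>x \<in> A. sat M e (f x))"
  using assms by (simp_all add: big_conj_def conjs_simps set_some_list)

definition inj_fm :: "nat set \<Rightarrow> fm" where
  "inj_fm I = big_conj {(i, j) \<in> I \<times> I. i \<noteq> j} (\<lambda>(i, j). Neg (Eq i j))"

lemma inj_fm_simps [simp]:
  assumes "finite I"
  shows "is_formula k (inj_fm I)"
    and "fv (inj_fm I) \<subseteq> I"
    and "sat M e (inj_fm I) \<longleftrightarrow> inj_on e I"
proof -
  have "finite {(i, j) \<in> I \<times> I. i \<noteq> j}"
    by (rule finite_subset[of _ "I \<times> I"]) (use assms in auto)
  then show "is_formula k (inj_fm I)" "fv (inj_fm I) \<subseteq> I" "sat M e (inj_fm I) \<longleftrightarrow> inj_on e I"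
    by (auto simp: inj_fm_def inj_on_def)
qed

text \<open>An atom needs an ordered list of variables. The increasing order is an arbitrary choice,
  harmless in hypergraphs because their relation is symmetric.\<close>

definition edge_fm :: "nat set \<Rightarrow> fm" where
  "edge_fm e = Rel (sorted_list_of_set e)"

lemma edge_fm_simps [simp]:
  "finite e \<Longrightarrow> is_formula k (edge_fm e) \<longleftrightarrow> card e = k"
  "finite e \<Longrightarrow> fv (edge_fm e) = e"
  by (simp_all add: edge_fm_def)

lemma nsetsD: "e \<in> nsets A m \<Longrightarrow> e \<subseteq> A \<and> finite e \<and> card e = m"
  unfolding nsets_def by auto

text \<open>Two repetition-free lists with the same underlying set are permutations of each other,
  so symmetry identifies them.\<close>

lemma hypergraph_rel_iff_edge:
  assumes "hypergraph k M" and "distinct xs"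
  shows "xs \<in> rel M \<longleftrightarrow> set xs \<in> edges M"
proof
  assume "set xs \<in> edges M"
  then obtain ys where ys: "ys \<in> rel M" "set xs = set ys" unfolding edges_def by auto
  then have "distinct ys" using assms(1) unfolding hypergraph_def by blast
  then have "mset xs = mset ys" using ys assms(2) set_eq_iff_mset_eq_distinct by blast
  then show "xs \<in> rel M" using assms(1) ys(1) unfolding hypergraph_def by blast
qed (auto simp: edges_def)

lemma hypergraph_edgeD:
  assumes "hypergraph k M" and "e \<in> edges M"
  shows "e \<in> nsets (univ M) k"
  using assms unfolding hypergraph_def is_struct_def edges_def nsets_def
  by (auto simp: distinct_card)

text \<open>If \<open>a\<close> identifies two variables of \<open>e\<close>, both sides are false:
  the tuple has a repetition, and \<open>a\<close> maps \<open>e\<close> to fewer than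
  \<open>k\<close> vertices.\<close>

lemma sat_edge_fm:
  assumes "hypergraph k M" and "finite e" and "card e = k"
  shows "sat M a (edge_fm e) \<longleftrightarrow> a ` e \<in> edges M"
proof (cases "inj_on a e")
  case True
  then show ?thesis
    using hypergraph_rel_iff_edge[OF assms(1), of "map a (sorted_list_of_set e)"] assms(2)
    by (simp add: edge_fm_def distinct_map)
next
  case False
  then have "a ` e \<notin> edges M"
    using hypergraph_edgeD[OF assms(1), of "a ` e"] nsetsD eq_card_imp_inj_on[OF assms(2)] assms(3)
    by metis
  moreover have "\<not> distinct (map a (sorted_list_of_set e))"
    using False assms(2) by (simp add: distinct_map)
  then have "\<not> sat M a (edge_fm e)"
    using assms(1) unfolding hypergraph_def edge_fm_def sat.simps by blast
  ultimately show ?thesis by simp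
qed

section \<open>The one-point extension property and its first-order form\<close>

lemma nsets_image_inj: "inj_on f A \<Longrightarrow> nsets (f ` A) m = (`) f ` nsets A m"
  using bij_betw_nsets[of f A "f ` A" m] by (simp add: bij_betw_def)

text \<open>\<open>E\<close> prescribes the link over \<open>A\<close> of a new vertex. The excluded
  sets \<open>v\<close> are those which the new vertex would complete to an
  \<open>n\<close>-clique.\<close>

definition extension_property :: "nat \<Rightarrow> nat \<Rightarrow> 'a struct \<Rightarrow> bool" where
  "extension_property n k M \<longleftrightarrow>
     (\<forall>A E. finite A \<and> A \<subseteq> univ M \<and> E \<subseteq> nsets A (k - 1) \<and>
        \<not> (\<exists>v \<in> nsets A (n - 1). nsets v k \<subseteq> edges M \<and> nsets v (k - 1) \<subseteq> E) \<longrightarrow>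
        (\<exists>x \<in> univ M - A. \<forall>e \<in> nsets A (k - 1). insert x e \<in> edges M \<longleftrightarrow> e \<in> E))"

lemma extension_propertyD:
  assumes "extension_property n k M" "finite A" "A \<subseteq> univ M" "E \<subseteq> nsets A (k - 1)"
    and "\<And>v. v \<in> nsets A (n - 1) \<Longrightarrow> nsets v k \<subseteq> edges M \<Longrightarrow> nsets v (k - 1) \<subseteq> E \<Longrightarrow> False"
  obtains x where "x \<in> univ M" "x \<notin> A"
    "\<And>e. e \<in> nsets A (k - 1) \<Longrightarrow> insert x e \<in> edges M \<longleftrightarrow> e \<in> E"
  using assms unfolding extension_property_def by (metis DiffD1 DiffD2)

definition clique_fm :: "nat \<Rightarrow> nat set \<Rightarrow> fm" where
  "clique_fm k v = big_conj (nsets v k) edge_fm"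

lemma finite_nsets [simp]: "finite A \<Longrightarrow> finite (nsets A m)"
  using finite_imp_finite_nsets by blast

lemma clique_fm_simps [simp]:
  assumes "finite v"
  shows "is_formula k (clique_fm k v)" and "fv (clique_fm k v) \<subseteq> v"
proof -
  have "fv (edge_fm e) \<subseteq> v" "is_formula k (edge_fm e)" if "e \<in> nsets v k" for e
    using nsetsD[OF that] by simp_all
  then show "is_formula k (clique_fm k v)" "fv (clique_fm k v) \<subseteq> v"
    using assms by (auto simp: clique_fm_def)
qed

lemma sat_clique_fm:
  assumes "hypergraph k M" and "finite v" and "inj_on a v"
  shows "sat M a (clique_fm k v) \<longleftrightarrow> nsets (a ` v) k \<subseteq> edges M"
proof -
  have "sat M a (edge_fm e) \<longleftrightarrow> a ` e \<in> edges M" if "e \<in> nsets v k" for e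
    using nsetsD[OF that] assms(1) by (intro sat_edge_fm) blast+
  then show ?thesis unfolding clique_fm_def using assms by (auto simp: nsets_image_inj)
qed

text \<open>The variables below \<open>r\<close> enumerate \<open>A\<close> and the variable
  \<open>r\<close> is the new vertex, so \<open>E\<close> consists of sets of indices. The outer
  \<open>Neg (Conj _ (Neg _))\<close> is an implication.\<close>

definition extension_fm :: "nat \<Rightarrow> nat \<Rightarrow> nat \<Rightarrow> nat set set \<Rightarrow> fm" where
  "extension_fm n k r E = Neg (Conj
     (Conj (inj_fm {..<r})
       (big_conj {v \<in> nsets {..<r} (n - 1). nsets v (k - 1) \<subseteq> E} (\<lambda>v. Neg (clique_fm k v))))
     (Neg (Ex r (Conj (inj_fm {..r})
       (Conj (big_conj E (\<lambda>e. edge_fm (insert r e)))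
         (big_conj (nsets {..<r} (k - 1) - E) (\<lambda>e. Neg (edge_fm (insert r e)))))))))"

lemma extension_fm_simps:
  assumes "E \<subseteq> nsets {..<r} (k - 1)" and "0 < k"
  shows "is_formula k (extension_fm n k r E)" and "fv (extension_fm n k r E) \<subseteq> {..<r}"
proof -
  have fin: "finite E" using assms(1) finite_subset by fastforce
  have card: "card (insert r e) = k" "finite e" if "e \<in> nsets {..<r} (k - 1)" for e
    using nsetsD[OF that] assms(2) by (auto simp: card_insert_if)
  have fin': "finite {v \<in> nsets {..<r} (n - 1). nsets v (k - 1) \<subseteq> E}" by simp
  show "is_formula k (extension_fm n k r E)"
    using fin fin' card assms(1) by (auto simp: extension_fm_def dest: nsetsD)
  have 1: "fv (inj_fm {..r}) \<subseteq> {..r}" "fv (inj_fm {..<r}) \<subseteq> {..<r}" by simp_all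
  have 2: "fv (clique_fm k v) \<subseteq> {..<r}" if "v \<in> nsets {..<r} (n - 1)" for v
    using clique_fm_simps(2)[of v k] nsetsD[OF that] by blast
  have 3: "fv (edge_fm (insert r e)) \<subseteq> {..r}" if "e \<in> nsets {..<r} (k - 1)" for e
    using nsetsD[OF that] by auto
  have 4: "{..r} - {r} = {..<r}" by auto
  have "fv (extension_fm n k r E) \<subseteq> {..<r} \<union> ({..r} - {r})"
    unfolding extension_fm_def fv.simps big_conj_simps(2)[OF fin] big_conj_simps(2)[OF fin']
      big_conj_simps(2)[OF finite_Diff[OF finite_nsets[OF finite_lessThan]]]
    by (intro Un_mono Un_least Diff_mono UN_least 1 order_refl) (use 1 2 3 assms(1) in blast)+
  then show "fv (extension_fm n k r E) \<subseteq> {..<r}" unfolding 4 by blast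
qed

lemma sat_extension_fm:
  assumes M: "hypergraph k M" and k: "0 < k" and E: "E \<subseteq> nsets {..<r} (k - 1)"
  shows "sat M a (extension_fm n k r E) \<longleftrightarrow>
    (inj_on a {..<r} \<and>
      (\<forall>v \<in> nsets {..<r} (n - 1). nsets v (k - 1) \<subseteq> E \<longrightarrow> \<not> nsets (a ` v) k \<subseteq> edges M) \<longrightarrow>
      (\<exists>x \<in> univ M - a ` {..<r}. \<forall>e \<in> nsets {..<r} (k - 1).
         insert x (a ` e) \<in> edges M \<longleftrightarrow> e \<in> E))"
proof (cases "inj_on a {..<r}")
  case True
  have fin: "finite E" using E finite_subset by fastforce
  have fin': "finite {v \<in> nsets {..<r} (n - 1). nsets v (k - 1) \<subseteq> E}" by simp
  have clique: "sat M a (clique_fm k v) \<longleftrightarrow> nsets (a ` v) k \<subseteq> edges M"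
    if "v \<in> nsets {..<r} (n - 1)" for v
    using nsetsD[OF that] True M inj_on_subset by (intro sat_clique_fm) blast+
  \<comment> \<open>Given that \<open>a\<close> is injective below \<open>r\<close>,
    \<open>inj_fm {..r}\<close> says precisely that the new vertex lies outside
    \<open>A\<close>.\<close>
  have inj: "inj_on (a(r := x)) {..r} \<longleftrightarrow> x \<notin> a ` {..<r}" for x
  proof -
    have "{..r} = insert r {..<r}" by auto
    moreover have "inj_on (a(r := x)) {..<r} \<longleftrightarrow> inj_on a {..<r}" by (rule inj_on_cong) auto
    moreover have "(a(r := x)) ` {..<r} = a ` {..<r}" by (rule image_cong) auto
    ultimately show ?thesis using True by (simp add: inj_on_insert)
  qed
  have edge: "sat M (a(r := x)) (edge_fm (insert r e)) \<longleftrightarrow> insert x (a ` e) \<in> edges M"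
    if "e \<in> nsets {..<r} (k - 1)" for e x
  proof -
    note e = nsetsD[OF that]
    have "card (insert r e) = k" using e k by (auto simp: card_insert_if)
    moreover have "(a(r := x)) ` insert r e = insert x (a ` e)" using e by auto
    ultimately show ?thesis using sat_edge_fm[OF M, of "insert r e" "a(r := x)"] e by (metis finite_insert)
  qed
  have ext: "(\<forall>e\<in>E. sat M (a(r := x)) (edge_fm (insert r e))) \<and>
      (\<forall>e\<in>nsets {..<r} (k - 1) - E. \<not> sat M (a(r := x)) (edge_fm (insert r e))) \<longleftrightarrow>
      (\<forall>e \<in> nsets {..<r} (k - 1). insert x (a ` e) \<in> edges M \<longleftrightarrow> e \<in> E)" for x
    using edge E by blast
  have "(\<exists>x\<in>univ M. inj_on (a(r := x)) {..r} \<and>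
      (\<forall>e\<in>E. sat M (a(r := x)) (edge_fm (insert r e))) \<and>
      (\<forall>e\<in>nsets {..<r} (k - 1) - E. \<not> sat M (a(r := x)) (edge_fm (insert r e)))) \<longleftrightarrow>
      (\<exists>x\<in>univ M - a ` {..<r}. \<forall>e\<in>nsets {..<r} (k - 1).
         insert x (a ` e) \<in> edges M \<longleftrightarrow> e \<in> E)"
    unfolding inj Bex_def Diff_iff conj_assoc using ext by blast
  moreover have "(\<forall>v\<in>{v \<in> nsets {..<r} (n - 1). nsets v (k - 1) \<subseteq> E}. \<not> sat M a (clique_fm k v)) \<longleftrightarrow>
      (\<forall>v \<in> nsets {..<r} (n - 1). nsets v (k - 1) \<subseteq> E \<longrightarrow> \<not> nsets (a ` v) k \<subseteq> edges M)"
    using clique by blast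
  ultimately show ?thesis
    unfolding extension_fm_def sat.simps big_conj_simps(3)[OF fin] big_conj_simps(3)[OF fin']
      big_conj_simps(3)[OF finite_Diff[OF finite_nsets[OF finite_lessThan]]]
      inj_fm_simps(3)[OF finite_lessThan] inj_fm_simps(3)[OF finite_atMost]
    by argo
qed (simp add: extension_fm_def)

section \<open>Fraisse limits have the extension property\<close>

lemma struct_of_edges_simps [simp]:
  "univ (struct_of_edges k V S) = V"
  "rel (struct_of_edges k V S) = {xs. length xs = k \<and> distinct xs \<and> set xs \<subseteq> V \<and> set xs \<in> S}"
  by (simp_all add: struct_of_edges_def)

lemma hypergraph_struct_of_edges: "hypergraph k (struct_of_edges k V S)"
  unfolding hypergraph_def is_struct_def
  by (auto dest: mset_eq_length mset_eq_setD mset_eq_imp_distinct_iff)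

lemma edges_struct_of_edges: "edges (struct_of_edges k V S) = S \<inter> nsets V k"
proof
  show "S \<inter> nsets V k \<subseteq> edges (struct_of_edges k V S)"
  proof
    fix e assume e: "e \<in> S \<inter> nsets V k"
    then obtain xs where "set xs = e" "distinct xs"
      using finite_distinct_list nsetsD by (metis IntD2)
    then show "e \<in> edges (struct_of_edges k V S)"
      using e by (auto simp: edges_def nsets_def distinct_card intro!: image_eqI[of _ _ xs])
  qed
qed (auto simp: edges_def nsets_def distinct_card)

text \<open>The vertices of \<open>F\<close> are natural numbers, so a finite substructure is itself
  a member of the age, by the identity embedding.\<close>

lemma fraisse_limit_age:
  fixes F :: "nat struct"
  assumes "fraisse_limit k K F" and "finite A" and "A \<subseteq> univ F"
  shows "substruct F A \<in> K"
proof -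
  have "is_struct k (substruct F A)"
    using assms by (auto simp: fraisse_limit_def is_struct_def substruct_def)
  moreover have "embedding id (substruct F A) F"
    using assms by (auto simp: embedding_def substruct_def)
  ultimately show ?thesis
    using assms unfolding fraisse_limit_def age_def
    by (auto simp: substruct_def)
qed

text \<open>A tuple and its permutations live on one finite substructure, which belongs to the age
  and hence is a hypergraph.\<close>

lemma fraisse_limit_hypergraph:
  assumes F: "fraisse_limit k (fin_clique_free_hypergraphs n k) F"
  shows "hypergraph k F"
proof -
  have str: "is_struct k F" using F by (simp add: fraisse_limit_def)
  have hyp: "hypergraph k (substruct F (set xs))" if "xs \<in> rel F" for xs
    using fraisse_limit_age[OF F, of "set xs"] str that
    by (auto simp: is_struct_def fin_clique_free_hypergraphs_def fin_hypergraphs_def)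
  show ?thesis
    unfolding hypergraph_def
  proof (intro conjI ballI allI impI str)
    fix xs assume xs: "xs \<in> rel F"
    then have xs': "xs \<in> rel (substruct F (set xs))" by (simp add: substruct_def)
    then show "distinct xs" using hyp[OF xs] unfolding hypergraph_def by blast
    fix ys assume "mset ys = mset xs"
    then have "ys \<in> rel (substruct F (set xs))" using hyp[OF xs] xs' unfolding hypergraph_def by blast
    then show "ys \<in> rel F" by (simp add: substruct_def)
  qed
qed

lemma fraisse_limit_clique_free:
  assumes F: "fraisse_limit k (fin_clique_free_hypergraphs n k) F"
  shows "clique_free n k F"
  unfolding clique_free_def
proof
  assume "\<exists>v\<in>nsets (univ F) n. nsets v k \<subseteq> edges F"
  then obtain v where v: "v \<in> nsets (univ F) n" "nsets v k \<subseteq> edges F" by blast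
  have "clique_free n k (substruct F v)"
    using fraisse_limit_age[OF F, of v] nsetsD[OF v(1)]
    by (auto simp: fin_clique_free_hypergraphs_def)
  moreover have "nsets v k \<subseteq> edges (substruct F v)"
  proof
    fix e assume e: "e \<in> nsets v k"
    then obtain xs where "xs \<in> rel F" "set xs = e" using v(2) unfolding edges_def by blast
    then show "e \<in> edges (substruct F v)"
      using nsetsD[OF e] by (auto simp: edges_def substruct_def)
  qed
  moreover have "v \<in> nsets (univ (substruct F v)) n"
    using v(1) by (auto simp: nsets_def substruct_def)
  ultimately show False unfolding clique_free_def by blast
qed

lemma hypergraph_embedding_edge:
  assumes "hypergraph k A" "hypergraph k M" "embedding f A M" "e \<subseteq> univ A" "finite e"
  shows "f ` e \<in> edges M \<longleftrightarrow> e \<in> edges A"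
proof -
  obtain xs where xs: "set xs = e" "distinct xs" using assms(5) finite_distinct_list by blast
  have "inj_on f e" using assms(3,4) inj_on_subset unfolding embedding_def by blast
  then show ?thesis
    using hypergraph_rel_iff_edge[OF assms(1) xs(2)] hypergraph_rel_iff_edge[OF assms(2), of "map f xs"]
      assms(3,4) xs
    by (auto simp: embedding_def distinct_map)
qed

text \<open>The prescribed one-point extension \<open>B\<close> of \<open>A\<close> is clique-free,
  so it embeds into \<open>F\<close> by some \<open>h\<close>. Homogeneity gives an automorphism
  \<open>g\<close> carrying the copy of \<open>A\<close> back onto \<open>A\<close>, and
  \<open>g (h z)\<close> is the required vertex.\<close>

lemma fraisse_limit_extension_property:
  assumes F: "fraisse_limit k (fin_clique_free_hypergraphs n k) F" and k: "0 < k" "k < n"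
  shows "extension_property n k F"
  unfolding extension_property_def
proof (intro allI impI, elim conjE)
  fix A E assume A: "finite A" "A \<subseteq> univ F" and E: "E \<subseteq> nsets A (k - 1)"
    and free: "\<not> (\<exists>v\<in>nsets A (n - 1). nsets v k \<subseteq> edges F \<and> nsets v (k - 1) \<subseteq> E)"
  note hyp = fraisse_limit_hypergraph[OF F]
  \<comment> \<open>\<open>z\<close> is merely a fresh name. Even if it happens to be a vertex of
    \<open>F\<close>, the edges of \<open>B\<close> through \<open>z\<close> come from
    \<open>E\<close> alone.\<close>
  obtain z where z: "z \<notin> A" using ex_new_if_finite A(1) infinite_UNIV_nat by blast
  define B where "B = struct_of_edges k (insert z A) ({e \<in> edges F. e \<subseteq> A} \<union> insert z ` E)"
  have hypB: "hypergraph k B" unfolding B_def by (rule hypergraph_struct_of_edges)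
  have univB: "univ B = insert z A" by (simp add: B_def)
  have edgesB: "edges B = {e \<in> edges F. e \<subseteq> A} \<union> insert z ` E"
  proof -
    have "{e \<in> edges F. e \<subseteq> A} \<subseteq> nsets (insert z A) k"
      using hypergraph_edgeD[OF hyp] by (auto simp: nsets_def)
    moreover have "insert z ` E \<subseteq> nsets (insert z A) k"
    proof
      fix u assume "u \<in> insert z ` E"
      then obtain e where e: "u = insert z e" "e \<in> nsets A (k - 1)" using E by blast
      then show "u \<in> nsets (insert z A) k"
        using nsetsD[OF e(2)] z k(1) by (auto simp: nsets_def card_insert_if)
    qed
    ultimately show ?thesis unfolding B_def edges_struct_of_edges by blast
  qed
  have edge_z: "insert z e \<in> edges B \<longleftrightarrow> e \<in> E" if "e \<subseteq> A" for e
  proof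
    assume "insert z e \<in> edges B"
    then have "insert z e \<in> insert z ` E" unfolding edgesB using z by auto
    then obtain e' where e': "e' \<in> E" "insert z e = insert z e'" by blast
    moreover have "e' \<subseteq> A" using e'(1) E nsetsD by blast
    ultimately have "e = e'" using z that by (metis insert_ident subsetD)
    with e' show "e \<in> E" by simp
  qed (simp add: edgesB)
  have edge_A: "e \<in> edges B \<longleftrightarrow> e \<in> edges F" if "e \<subseteq> A" for e
    using that z by (auto simp: edgesB)
  have "clique_free n k B"
    unfolding clique_free_def
  proof
    assume "\<exists>v\<in>nsets (univ B) n. nsets v k \<subseteq> edges B"
    then obtain v where v: "v \<subseteq> insert z A" "finite v" "card v = n" "nsets v k \<subseteq> edges B"
      by (auto simp: univB dest: nsetsD)
    show False
    proof (cases "z \<in> v")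
      case True
      \<comment> \<open>Without \<open>z\<close>, an \<open>n\<close>-clique of \<open>B\<close>
        through \<open>z\<close> is an \<open>(n - 1)\<close>-clique of \<open>F\<close> in
        \<open>A\<close> with all its \<open>(k - 1)\<close>-subsets in \<open>E\<close>, which
        \<open>free\<close> excludes.\<close>
      define w where "w = v - {z}"
      have w: "w \<in> nsets A (n - 1)" using v True by (auto simp: nsets_def w_def)
      have "nsets w k \<subseteq> edges F"
      proof
        fix e assume e: "e \<in> nsets w k"
        then have "e \<in> nsets v k" by (auto simp: nsets_def w_def)
        then show "e \<in> edges F" using v(4) edge_A nsetsD[OF e] nsetsD[OF w] by blast
      qed
      moreover have "nsets w (k - 1) \<subseteq> E"
      proof
        fix e assume e: "e \<in> nsets w (k - 1)"
        then have "insert z e \<in> nsets v k"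
          using True k(1) by (auto simp: nsets_def w_def card_insert_if)
        then show "e \<in> E" using v(4) edge_z nsetsD[OF e] nsetsD[OF w] by blast
      qed
      ultimately show False using free w by blast
    next
      case False
      then have "v \<in> nsets (univ F) n" using v A by (auto simp: nsets_def)
      moreover have "nsets v k \<subseteq> edges F"
      proof
        fix e assume e: "e \<in> nsets v k"
        then show "e \<in> edges F" using v(1,4) False edge_A nsetsD[OF e] by blast
      qed
      ultimately show False using fraisse_limit_clique_free[OF F] unfolding clique_free_def by blast
    qed
  qed
  then have "B \<in> age k F"
    using F hypB A(1) univB
    by (auto simp: fraisse_limit_def fin_clique_free_hypergraphs_def fin_hypergraphs_def)
  then obtain h where h: "embedding h B F" unfolding age_def by blast
  \<comment> \<open>Homogeneity will be applied to \<open>f\<close>, the inverse of \<open>h\<close>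
    on the copy of \<open>A\<close>.\<close>
  define f where "f = inv_into A h"
  have injh: "inj_on h (insert z A)" and hF: "h ` insert z A \<subseteq> univ F"
    using h univB by (auto simp: embedding_def)
  have injA: "inj_on h A" using injh inj_on_subset by blast
  have fh: "f (h a) = a" if "a \<in> A" for a using that injA by (simp add: f_def)
  have "embedding f (substruct F (h ` A)) F"
    unfolding embedding_def
  proof (intro conjI allI impI)
    show "inj_on f (univ (substruct F (h ` A)))"
      using fh by (auto simp: substruct_def inj_on_def)
    show "f ` univ (substruct F (h ` A)) \<subseteq> univ F"
      using fh A by (auto simp: substruct_def)
    fix xs assume "set xs \<subseteq> univ (substruct F (h ` A))"
    then have xs: "set xs \<subseteq> h ` A" by (simp add: substruct_def)
    define ys where "ys = map f xs"
    have ys: "set ys \<subseteq> A" using xs fh by (auto simp: ys_def)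
    have xs_eq: "xs = map h ys"
      unfolding ys_def map_map by (rule map_idI[symmetric]) (use xs fh in auto)
    have "xs \<in> rel (substruct F (h ` A)) \<longleftrightarrow> map h ys \<in> rel F"
      using xs xs_eq by (simp add: substruct_def)
    also have "\<dots> \<longleftrightarrow> ys \<in> rel B" using h ys univB by (auto simp: embedding_def)
    also have "\<dots> \<longleftrightarrow> ys \<in> rel F"
    \<comment> \<open>Edges decide the relation on repetition-free tuples; on the others it fails in
      both hypergraphs.\<close>
    proof (cases "distinct ys")
      case True
      then show ?thesis
        using hypergraph_rel_iff_edge[OF hypB True] hypergraph_rel_iff_edge[OF hyp True] edge_A ys
        by simp
    next
      case False
      then show ?thesis using hyp hypB unfolding hypergraph_def by blast
    qed
    finally show "xs \<in> rel (substruct F (h ` A)) \<longleftrightarrow> map f xs \<in> rel F" unfolding ys_def .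
  qed
  then obtain g where g: "automorphism g F" "\<forall>x \<in> h ` A. g x = f x"
    using F A(1) hF unfolding fraisse_limit_def ultrahomogeneous_def
    by (metis finite_imageI image_mono order_trans subset_insertI)
  have gemb: "embedding g F F" using g(1) by (simp add: automorphism_def)
  have gh: "g (h a) = a" if "a \<in> A" for a using g(2) fh that by simp
  define x where "x = g (h z)"
  have "x \<in> univ F" using gemb hF by (auto simp: embedding_def x_def)
  moreover have "x \<notin> A"
  proof
    assume x: "x \<in> A"
    then have "g (h x) = g (h z)" using gh x_def by simp
    moreover have "inj_on g (univ F)" using gemb by (simp add: embedding_def)
    ultimately have "h x = h z" using hF x by (auto dest: inj_onD)
    then show False using inj_onD[OF injh, of x z] x z by blast
  qed
  moreover have "insert x e \<in> edges F \<longleftrightarrow> e \<in> E" if e: "e \<in> nsets A (k - 1)" for e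
  proof -
    note eA = nsetsD[OF e]
    have "insert x e = g ` h ` insert z e"
      using gh eA by (force simp: x_def image_iff)
    also have "\<dots> \<in> edges F \<longleftrightarrow> h ` insert z e \<in> edges F"
      using eA hF by (intro hypergraph_embedding_edge[OF hyp hyp gemb]) auto
    also have "\<dots> \<longleftrightarrow> insert z e \<in> edges B"
      using eA univB by (intro hypergraph_embedding_edge[OF hypB hyp h]) auto
    also have "\<dots> \<longleftrightarrow> e \<in> E" using edge_z eA by blast
    finally show ?thesis .
  qed
  ultimately show "\<exists>x\<in>univ F - A. \<forall>e\<in>nsets A (k - 1). (insert x e \<in> edges F) = (e \<in> E)" by blast
qed

section \<open>Models\<close>

lemma T_clique_free_hypergraph:
  assumes M: "is_model k (T_clique_free n k) M"
  shows "hypergraph k M"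
  unfolding hypergraph_def
proof (intro conjI ballI allI impI)
  show str: "is_struct k M" using M by (simp add: is_model_def)
  fix xs assume xs: "xs \<in> rel M"
  then have xsM: "length xs = k" "set xs \<subseteq> univ M" using str by (auto simp: is_struct_def)
  \<comment> \<open>The entries of \<open>xs\<close> are named by variables: \<open>g\<close> sends
    an entry to its variable and \<open>e\<close> evaluates it back, so under \<open>e\<close> the
    atom \<open>Rel (map g xs)\<close> says that \<open>xs\<close> is in the relation.\<close>
  obtain e where e: "bij_betw e {..<card (set xs)} (set xs)"
    using ex_bij_betw_nat_finite[of "set xs"] by (auto simp: atLeast0LessThan)
  define g where "g = inv_into {..<card (set xs)} e"
  have ge: "e (g a) = a" if "a \<in> set xs" for a
    unfolding g_def using that e by (rule bij_betw_inv_into_right[rotated])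
  have eq: "map e (map g zs) = zs" if "set zs \<subseteq> set xs" for zs
    unfolding map_map by (rule map_idI) (use that ge in auto)
  show "distinct xs"
  proof (rule ccontr)
    assume "\<not> distinct xs"
    \<comment> \<open>A repeated entry becomes a repeated variable, which makes the atom false under
      every assignment in a limit.\<close>
    then have nd: "\<not> distinct (map g xs)" by (auto simp: distinct_map)
    have "sat M e (Neg (Rel (map g xs)))"
    proof (rule T_clique_free_transfer[OF M, where I = "g ` set xs"])
      fix F :: "nat struct" and e' :: "nat \<Rightarrow> nat"
    assume F: "fraisse_limit k (fin_clique_free_hypergraphs n k) F"
      have "\<not> distinct (map e' (map g xs))" using nd distinct_map by blast
      then show "sat F e' (Neg (Rel (map g xs)))"
        using fraisse_limit_hypergraph[OF F] unfolding hypergraph_def sat.simps by blast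
    qed (use xsM ge in auto)
    then show False using eq[of xs] xs by simp
  qed
  fix ys assume ys: "mset ys = mset xs"
  have "sat M e (Neg (Conj (Rel (map g xs)) (Neg (Rel (map g ys)))))"
  proof (rule T_clique_free_transfer[OF M, where I = "g ` set xs"])
    fix F :: "nat struct" and e' :: "nat \<Rightarrow> nat"
    assume F: "fraisse_limit k (fin_clique_free_hypergraphs n k) F"
    have "mset (map e' (map g ys)) = mset (map e' (map g xs))" using ys by simp
    then show "sat F e' (Neg (Conj (Rel (map g xs)) (Neg (Rel (map g ys)))))"
      using fraisse_limit_hypergraph[OF F] unfolding hypergraph_def sat.simps by blast
  qed (use xsM ge mset_eq_setD[OF ys] mset_eq_length[OF ys] in auto)
  then show "ys \<in> rel M" using eq[of xs] eq[of ys] xs mset_eq_setD[OF ys] by simp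
qed

lemma T_clique_free_clique_free:
  assumes M: "is_model k (T_clique_free n k) M"
  shows "clique_free n k M"
  unfolding clique_free_def
proof
  assume "\<exists>v\<in>nsets (univ M) n. nsets v k \<subseteq> edges M"
  then obtain v where v: "v \<in> nsets (univ M) n" "nsets v k \<subseteq> edges M" by blast
  obtain a where "bij_betw a {..<card v} v"
    using ex_bij_betw_nat_finite[of v] nsetsD[OF v(1)] by (auto simp: atLeast0LessThan)
  then have inj: "inj_on a {..<n}" and im: "a ` {..<n} = v"
    using nsetsD[OF v(1)] by (auto simp: bij_betw_def)
  let ?\<phi> = "Neg (Conj (inj_fm {..<n}) (clique_fm k {..<n}))"
  have fv: "fv ?\<phi> \<subseteq> {..<n}" by simp
  have "sat M a ?\<phi>"
  proof (rule T_clique_free_transfer[OF M _ finite_lessThan fv])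
    show "\<forall>i\<in>{..<n}. a i \<in> univ M" using im nsetsD[OF v(1)] by blast
    fix F :: "nat struct" and e :: "nat \<Rightarrow> nat"
    assume F: "fraisse_limit k (fin_clique_free_hypergraphs n k) F"
    note hyp = fraisse_limit_hypergraph[OF F]
    assume e: "\<forall>i\<in>{..<n}. e i \<in> univ F"
    have "\<not> nsets (e ` {..<n}) k \<subseteq> edges F" if inj: "inj_on e {..<n}"
    proof -
      have "e ` {..<n} \<in> nsets (univ F) n" using e inj by (auto simp: nsets_def card_image)
      then show ?thesis using fraisse_limit_clique_free[OF F] unfolding clique_free_def by blast
    qed
    then show "sat F e ?\<phi>" using sat_clique_fm[OF hyp] by auto
  qed simp
  then show False
    using sat_clique_fm[OF T_clique_free_hypergraph[OF M] _ inj] inj im v(2) by simp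
qed

lemma T_clique_free_extension_property:
  assumes M: "is_model k (T_clique_free n k) M" and k: "0 < k" "k < n"
  shows "extension_property n k M"
  unfolding extension_property_def
proof (intro allI impI, elim conjE)
  fix A E assume A: "finite A" "A \<subseteq> univ M" and E: "E \<subseteq> nsets A (k - 1)"
    and free: "\<not> (\<exists>v\<in>nsets A (n - 1). nsets v k \<subseteq> edges M \<and> nsets v (k - 1) \<subseteq> E)"
  define r where "r = card A"
  obtain a where "bij_betw a {..<r} A"
    using ex_bij_betw_nat_finite[OF A(1)] by (auto simp: r_def atLeast0LessThan)
  then have inj: "inj_on a {..<r}" and im: "a ` {..<r} = A" by (auto simp: bij_betw_def)
  \<comment> \<open>\<open>E'\<close> is \<open>E\<close> pulled back to the indices enumerating
    \<open>A\<close>, the form in which \<open>extension_fm\<close> takes it.\<close>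
  define E' where "E' = {e \<in> nsets {..<r} (k - 1). a ` e \<in> E}"
  have E': "E' \<subseteq> nsets {..<r} (k - 1)" by (auto simp: E'_def)
  have "sat M a (extension_fm n k r E')"
  proof (rule T_clique_free_transfer[OF M _ finite_lessThan])
    show "is_formula k (extension_fm n k r E')" "fv (extension_fm n k r E') \<subseteq> {..<r}"
      using extension_fm_simps[OF E' k(1)] .
    show "\<forall>i\<in>{..<r}. a i \<in> univ M" using im A(2) by blast
    fix F :: "nat struct" and e :: "nat \<Rightarrow> nat"
    assume F: "fraisse_limit k (fin_clique_free_hypergraphs n k) F"
    note hyp = fraisse_limit_hypergraph[OF F]
    assume e: "\<forall>i\<in>{..<r}. e i \<in> univ F"
    show "sat F e (extension_fm n k r E')"
      unfolding sat_extension_fm[OF hyp k(1) E']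
    proof (intro impI, elim conjE)
      assume inj: "inj_on e {..<r}"
        and free: "\<forall>v\<in>nsets {..<r} (n - 1). nsets v (k - 1) \<subseteq> E' \<longrightarrow> \<not> nsets (e ` v) k \<subseteq> edges F"
      \<comment> \<open>As \<open>e\<close> is injective on the indices, an index set can be
        recovered from its image; this carries \<open>E'\<close> faithfully into
        \<open>F\<close>.\<close>
      have mem: "e ` u \<in> (`) e ` E' \<longleftrightarrow> u \<in> E'" if "u \<subseteq> {..<r}" for u
        using that E' inj by (auto simp: inj_on_image_eq_iff dest!: nsetsD)
      have sub: "(`) e ` E' \<subseteq> nsets (e ` {..<r}) (k - 1)"
        using E' nsets_image_inj[OF inj] by blast
      obtain x where "x \<in> univ F" "x \<notin> e ` {..<r}"
        "\<And>u. u \<in> nsets (e ` {..<r}) (k - 1) \<Longrightarrow> insert x u \<in> edges F \<longleftrightarrow> u \<in> (`) e ` E'"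
      proof (rule extension_propertyD[OF fraisse_limit_extension_property[OF F k] _ _ sub])
        fix w assume w: "w \<in> nsets (e ` {..<r}) (n - 1)" "nsets w k \<subseteq> edges F"
          "nsets w (k - 1) \<subseteq> (`) e ` E'"
        obtain v where v: "v \<in> nsets {..<r} (n - 1)" "w = e ` v"
          using w(1) unfolding nsets_image_inj[OF inj] by blast
        have "inj_on e v" using nsetsD[OF v(1)] inj inj_on_subset by blast
        have "nsets v (k - 1) \<subseteq> E'"
        proof
          fix u assume u: "u \<in> nsets v (k - 1)"
          then have "e ` u \<in> nsets w (k - 1)"
            unfolding v(2) nsets_image_inj[OF \<open>inj_on e v\<close>] by (rule imageI)
          then have "e ` u \<in> (`) e ` E'" using w(3) by (rule set_mp[rotated])
          moreover have "u \<subseteq> {..<r}" using nsetsD[OF u] nsetsD[OF v(1)] by blast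
          ultimately show "u \<in> E'" using mem by simp
        qed
        then show False using free v w(2) by blast
      qed (use e in auto)
      then show "\<exists>x\<in>univ F - e ` {..<r}. \<forall>u\<in>nsets {..<r} (k - 1).
          (insert x (e ` u) \<in> edges F) = (u \<in> E')"
        using mem nsetsD nsets_image_inj[OF inj, of "k - 1"] by (metis DiffI imageI)
    qed
  qed
  moreover have "\<not> nsets (a ` v) k \<subseteq> edges M"
    if v: "v \<in> nsets {..<r} (n - 1)" "nsets v (k - 1) \<subseteq> E'" for v
  proof
    assume "nsets (a ` v) k \<subseteq> edges M"
    moreover have "a ` v \<in> nsets A (n - 1)" using v(1) nsets_image_inj[OF inj] im by blast
    moreover have "nsets (a ` v) (k - 1) \<subseteq> E"
      using nsets_image_inj[of a v "k - 1"] inj_on_subset[OF inj] nsetsD[OF v(1)] v(2)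
      by (auto simp: E'_def)
    ultimately show False using free by blast
  qed
  ultimately obtain x where x: "x \<in> univ M - A"
    "\<forall>e \<in> nsets {..<r} (k - 1). insert x (a ` e) \<in> edges M \<longleftrightarrow> e \<in> E'"
    using sat_extension_fm[OF T_clique_free_hypergraph[OF M] k(1) E'] inj im by auto
  have "insert x e \<in> edges M \<longleftrightarrow> e \<in> E" if "e \<in> nsets A (k - 1)" for e
    using that nsets_image_inj[OF inj, of "k - 1"] im x(2) by (auto simp: E'_def)
  with x(1) show "\<exists>x\<in>univ M - A. \<forall>e\<in>nsets A (k - 1). (insert x e \<in> edges M) = (e \<in> E)" by blast
qed

section \<open>Embedding a countable clique-free hypergraph\<close>

text \<open>A \<open>k\<close>-subset either avoids \<open>z\<close> or consists of \<open>z\<close>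
  and a \<open>(k - 1)\<close>-subset of \<open>w\<close>.\<close>

lemma nsets_insert_subset_iff:
  assumes "z \<notin> w" and "0 < k"
  shows "nsets (insert z w) k \<subseteq> G \<longleftrightarrow> nsets w k \<subseteq> G \<and> (\<forall>e \<in> nsets w (k - 1). insert z e \<in> G)"
proof (intro iffI conjI ballI)
  assume G: "nsets (insert z w) k \<subseteq> G"
  then show "nsets w k \<subseteq> G" using nsets_mono[of w "insert z w"] by blast
  fix e assume "e \<in> nsets w (k - 1)"
  then have "insert z e \<in> nsets (insert z w) k"
    using assms by (auto simp: nsets_def card_insert_if)
  then show "insert z e \<in> G" using G by blast
next
  assume G: "nsets w k \<subseteq> G \<and> (\<forall>e \<in> nsets w (k - 1). insert z e \<in> G)"
  show "nsets (insert z w) k \<subseteq> G"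
  proof
    fix e assume e: "e \<in> nsets (insert z w) k"
    show "e \<in> G"
    proof (cases "z \<in> e")
      case True
      then have "e - {z} \<in> nsets w (k - 1)" using e by (auto simp: nsets_def)
      then have "insert z (e - {z}) \<in> G" using G by blast
      then show ?thesis using True by (simp add: insert_absorb)
    next
      case False
      then have "e \<in> nsets w k" using e by (auto simp: nsets_def)
      then show ?thesis using G by blast
    qed
  qed
qed

text \<open>The vertices are placed one after another in the order of \<open>to_nat\<close>. Each
  has finitely many predecessors, and the clique-freeness of \<open>G\<close> makes its prescribed
  link admissible for the extension property.\<close>

lemma countable_embedding:
  fixes G :: "'v::countable set set"
  assumes ext: "extension_property n k M" and k: "0 < k" "0 < n"
    and free: "\<And>v. v \<in> nsets UNIV n \<Longrightarrow> \<not> nsets v k \<subseteq> G"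
  obtains f :: "'v \<Rightarrow> 'a" where "inj f" "range f \<subseteq> univ M"
    "\<And>e. e \<in> nsets UNIV k \<Longrightarrow> f ` e \<in> edges M \<longleftrightarrow> e \<in> G"
proof -
  define L where "L v = {u :: 'v. to_nat u < to_nat v}" for v :: 'v
  \<comment> \<open>\<open>P f v x\<close> says that \<open>x\<close> is a correct image of
    \<open>v\<close>, given the images \<open>f\<close> of the predecessors
    \<open>L v\<close>.\<close>
  define P where "P f v x \<longleftrightarrow> x \<in> univ M \<and> x \<notin> f ` L v \<and>
    (\<forall>e \<in> nsets (L v) (k - 1). insert x (f ` e) \<in> edges M \<longleftrightarrow> insert v e \<in> G)"
    for f :: "'v \<Rightarrow> 'a" and v x
  have finL: "finite (L v)" for v
  proof -
    have "to_nat ` L v \<subseteq> {..<to_nat v}" by (auto simp: L_def)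
    then show ?thesis
      using finite_imageD[of to_nat "L v"] finite_subset inj_on_subset[OF inj_to_nat] by blast
  qed
  \<comment> \<open>This and the next fact are stated for any \<open>D\<close> because they serve
    twice: for \<open>L v\<close> during the recursion and for the whole type at the end.\<close>
  have inj: "inj_on f D" if D: "\<forall>v \<in> D. P f v (f v)" for f :: "'v \<Rightarrow> 'a" and D
  proof (rule inj_onI, rule ccontr)
    fix u v assume uv: "u \<in> D" "v \<in> D" "f u = f v" "u \<noteq> v"
    then have "to_nat u \<noteq> to_nat v" by simp
    then consider "u \<in> L v" | "v \<in> L u" unfolding L_def mem_Collect_eq by linarith
    then show False
    proof cases
      case 1
      then show False using D uv unfolding P_def by (metis imageI)
    next
      case 2
      then show False using D uv unfolding P_def by (metis imageI)
    qed
  qed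
  have edge: "f ` e \<in> edges M \<longleftrightarrow> e \<in> G"
    if D: "\<forall>v \<in> D. P f v (f v)" and e: "e \<in> nsets D k" for f :: "'v \<Rightarrow> 'a" and D e
  proof -
    note e' = nsetsD[OF e]
    have "e \<noteq> {}" using e' k by auto
    then have "Max (to_nat ` e) \<in> to_nat ` e" using e' by simp
    \<comment> \<open>\<open>v\<close> is the last vertex of \<open>e\<close>; the others precede
      it, so the condition \<open>P\<close> at \<open>v\<close> decides \<open>e\<close>.\<close>
    then obtain v where v: "v \<in> e" "to_nat v = Max (to_nat ` e)" by auto
    have le: "to_nat u \<le> to_nat v" if "u \<in> e" for u using that e' v(2) by simp
    have "e - {v} \<subseteq> L v"
    proof
      fix u assume "u \<in> e - {v}"
      then have "to_nat u \<le> to_nat v" "to_nat u \<noteq> to_nat v" using le by auto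
      then show "u \<in> L v" unfolding L_def mem_Collect_eq by linarith
    qed
    then have "e - {v} \<in> nsets (L v) (k - 1)" using e' v(1) by (auto simp: nsets_def)
    then have "insert (f v) (f ` (e - {v})) \<in> edges M \<longleftrightarrow> insert v (e - {v}) \<in> G"
      using D v(1) e' unfolding P_def by blast
    then show ?thesis using v(1) by (simp add: insert_absorb flip: image_insert)
  qed
  \<comment> \<open>Recursive choice requires that \<open>P f v\<close> depend on \<open>f\<close>
    only through the predecessors of \<open>v\<close>, and that a value exist once they are placed
    correctly.\<close>
  have "\<exists>f. \<forall>v. P f v (f v)"
  proof (rule dependent_wf_choice[of "measure to_nat" P])
    fix f g :: "'v \<Rightarrow> 'a" and v x
    assume "\<And>z. (z, v) \<in> measure to_nat \<Longrightarrow> f z = g z"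
    then have eq: "f z = g z" if "z \<in> L v" for z using that by (simp add: L_def)
    have "f ` e = g ` e" if "e \<subseteq> L v" for e using that eq by (intro image_cong) auto
    then show "P f v x = P g v x" unfolding P_def using nsetsD by (metis order_refl)
  next
    fix v :: 'v and f :: "'v \<Rightarrow> 'a"
    assume "\<And>y. (y, v) \<in> measure to_nat \<Longrightarrow> P f y (f y)"
    then have D: "\<forall>y \<in> L v. P f y (f y)" by (auto simp: L_def)
    note injL = inj[OF D]
    define E where "E = (`) f ` {e \<in> nsets (L v) (k - 1). insert v e \<in> G}"
    have mem: "f ` e \<in> E \<longleftrightarrow> insert v e \<in> G" if "e \<in> nsets (L v) (k - 1)" for e
    proof -
      have "f ` e = f ` e' \<longleftrightarrow> e = e'" if "e' \<in> nsets (L v) (k - 1)" for e'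
        using inj_on_image_eq_iff[OF injL] nsetsD that \<open>e \<in> nsets (L v) (k - 1)\<close> by metis
      then show ?thesis unfolding E_def using that by blast
    qed
    have sub: "E \<subseteq> nsets (f ` L v) (k - 1)"
      unfolding E_def nsets_image_inj[OF injL] by blast
    obtain x where "x \<in> univ M" "x \<notin> f ` L v"
      "\<And>e. e \<in> nsets (f ` L v) (k - 1) \<Longrightarrow> insert x e \<in> edges M \<longleftrightarrow> e \<in> E"
    proof (rule extension_propertyD[OF ext _ _ sub])
      show "finite (f ` L v)" using finL by blast
      show "f ` L v \<subseteq> univ M" using D unfolding P_def by blast
      fix w assume w: "w \<in> nsets (f ` L v) (n - 1)" "nsets w k \<subseteq> edges M" "nsets w (k - 1) \<subseteq> E"
      obtain w' where w': "w' \<in> nsets (L v) (n - 1)" "w = f ` w'"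
        using w(1) unfolding nsets_image_inj[OF injL] by blast
      have injw: "inj_on f w'" using nsetsD[OF w'(1)] injL inj_on_subset by blast
      have sub': "nsets w' m \<subseteq> nsets (L v) m" for m using nsetsD[OF w'(1)] nsets_mono by blast
      have vw: "v \<notin> w'" using nsetsD[OF w'(1)] by (auto simp: L_def)
      \<comment> \<open>Pulled back along \<open>f\<close>, an obstruction to the extension becomes
        an \<open>n\<close>-clique of \<open>G\<close> on \<open>w'\<close> and
        \<open>v\<close>.\<close>
      have "nsets w' k \<subseteq> G"
        using w(2) edge[OF D] sub' unfolding w'(2) nsets_image_inj[OF injw] by blast
      moreover have "insert v e \<in> G" if "e \<in> nsets w' (k - 1)" for e
        using that w(3) mem sub' unfolding w'(2) nsets_image_inj[OF injw] by blast
      ultimately have "nsets (insert v w') k \<subseteq> G"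
        using nsets_insert_subset_iff[OF vw k(1)] by blast
      moreover have "insert v w' \<in> nsets UNIV n"
        using w'(1) vw k(2) by (auto simp: nsets_def)
      ultimately show False using free by blast
    qed blast
    then have "P f v x" unfolding P_def using mem nsets_image_inj[OF injL] by (metis imageI)
    then show "\<exists>r. P f v r" by blast
  qed simp
  then obtain f where f: "\<forall>v. P f v (f v)" by blast
  show thesis
    by (rule that[of f]) (use f inj[of UNIV f] edge[of UNIV f] in \<open>auto simp: P_def\<close>)
qed

section \<open>The coloured hypergraph\<close>

definition coloured_graph :: "nat \<Rightarrow> nat \<Rightarrow> nat \<Rightarrow> nat set set \<Rightarrow> (nat \<times> nat) set set" where
  "coloured_graph n n' k S = {e \<in> nsets UNIV k. inj_on snd e \<and> snd ` e \<subseteq> {..<n' - 1} \<and>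
     (snd ` e \<subseteq> {..<n - 1} \<longrightarrow> fst ` e \<in> S)}"

definition parameters :: "nat \<Rightarrow> nat \<Rightarrow> nat set \<Rightarrow> (nat \<times> nat) set" where
  "parameters n n' j = j \<times> {..<n - 1} \<union> {0} \<times> {n - 1..<n' - 1}"

lemma finite_parameters: "finite j \<Longrightarrow> finite (parameters n n' j)"
  by (simp add: parameters_def)

text \<open>The two parts use different colours and are disjoint. The size depends on
  \<open>j\<close> only through its cardinality, so all parameter tuples can have the same
  length.\<close>

lemma card_parameters:
  assumes "finite j"
  shows "card (parameters n n' j) = card j * (n - 1) + (n' - 1 - (n - 1))"
  unfolding parameters_def using assms
  by (subst card_Un_disjoint) (auto simp: card_cartesian_product)

text \<open>Any two vertices of a clique lie in a common edge, which reduces statements about pairs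
  of vertices to single edges.\<close>

lemma nsets_pair:
  assumes "finite w" and "2 \<le> k" and "k \<le> card w" and "p \<in> w" and "q \<in> w"
  obtains e where "e \<in> nsets w k" "p \<in> e" "q \<in> e"
proof -
  have "card {p, q} \<le> k" using assms(2) card_insert_le_m1[of 2 "{q}" p] by (auto simp: card_insert_if)
  then obtain e where "{p, q} \<subseteq> e" "e \<subseteq> w" "card e = k"
    using exists_subset_between[of "{p, q}" k w] assms by auto
  then show thesis using that assms(1) finite_subset by (auto simp: nsets_def)
qed

lemma coloured_graph_clique:
  assumes "finite w" and "2 \<le> k" and "k \<le> card w" and "nsets w k \<subseteq> coloured_graph n n' k S"
  shows "inj_on snd w" and "snd ` w \<subseteq> {..<n' - 1}"
proof -
  show "inj_on snd w"
  proof (rule inj_onI)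
    fix p q assume pq: "p \<in> w" "q \<in> w" "snd p = snd q"
    obtain e where "e \<in> nsets w k" "p \<in> e" "q \<in> e"
      using nsets_pair[OF assms(1-3) pq(1,2)] .
    then show "p = q" using assms(4) pq(3) by (auto simp: coloured_graph_def dest: inj_onD)
  qed
  show "snd ` w \<subseteq> {..<n' - 1}"
  proof
    fix c assume "c \<in> snd ` w"
    then obtain p where p: "p \<in> w" "c = snd p" by blast
    obtain e where "e \<in> nsets w k" "p \<in> e" using nsets_pair[OF assms(1-3) p(1) p(1)] .
    then show "c \<in> {..<n' - 1}" using assms(4) p(2) by (auto simp: coloured_graph_def)
  qed
qed

text \<open>The vertices of a clique have distinct colours, and only \<open>n' - 1\<close> colours
  are available.\<close>

lemma coloured_graph_clique_free:
  assumes "2 \<le> k" and "k \<le> n'" and "w \<in> nsets UNIV n'"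
  shows "\<not> nsets w k \<subseteq> coloured_graph n n' k S"
proof
  assume w: "nsets w k \<subseteq> coloured_graph n n' k S"
  note fin = nsetsD[OF assms(3)]
  have "inj_on snd w" "snd ` w \<subseteq> {..<n' - 1}"
    using coloured_graph_clique[OF _ assms(1) _ w] fin assms(2) by auto
  then have "n' \<le> n' - 1" using card_mono[of "{..<n' - 1}" "snd ` w"] fin by (simp add: card_image)
  then show False using assms(1,2) by simp
qed

text \<open>The clique \<open>w\<close> uses every colour exactly once. Its \<open>n - 1\<close>
  vertices of colour below \<open>n - 1\<close> form \<open>w0\<close>, and projecting
  \<open>w0\<close> to first coordinates gives the clique of \<open>S\<close>.\<close>

lemma clique_of_coloured_clique:
  assumes k: "2 \<le> k" "k < n" "n \<le> n'" and S: "S \<subseteq> nsets UNIV k" and s: "s \<subseteq> nsets UNIV (k - 1)"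
    and w: "w \<in> nsets UNIV (n' - 1)" "nsets w k \<subseteq> coloured_graph n n' k S"
    and ws: "\<And>u. u \<in> nsets w (k - 1) \<Longrightarrow> \<exists>j \<in> s. u \<subseteq> parameters n n' j"
  obtains v where "v \<in> nsets UNIV (n - 1)" "nsets v (k - 1) \<subseteq> s" "nsets v k \<subseteq> S"
proof -
  note fin = nsetsD[OF w(1)]
  have injw: "inj_on snd w" and sndw: "snd ` w \<subseteq> {..<n' - 1}"
    using coloured_graph_clique[OF _ k(1) _ w(2)] fin k by auto
  have sndw: "snd ` w = {..<n' - 1}"
    using sndw injw fin by (intro card_subset_eq) (auto simp: card_image)
  define w0 where "w0 = {p \<in> w. snd p < n - 1}"
  have w0: "w0 \<subseteq> w" "finite w0" using fin by (auto simp: w0_def)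
  have "snd ` w0 = {..<n - 1}"
  proof
    show "{..<n - 1} \<subseteq> snd ` w0"
    proof
      fix c assume c: "c \<in> {..<n - 1}"
      then have "c \<in> snd ` w" using sndw k(3) by auto
      then show "c \<in> snd ` w0" using c by (auto simp: w0_def)
    qed
  qed (auto simp: w0_def)
  then have card0: "card w0 = n - 1"
    using card_image[OF inj_on_subset[OF injw w0(1)]] by simp
  have edge: "fst ` e \<in> S" if "e \<in> nsets w0 k" for e
  proof -
    have "e \<in> coloured_graph n n' k S" using that w(2) nsets_mono[OF w0(1)] by blast
    moreover have "snd ` e \<subseteq> {..<n - 1}" using nsetsD[OF that] by (auto simp: w0_def)
    ultimately show ?thesis by (simp add: coloured_graph_def)
  qed
  \<comment> \<open>Two vertices of \<open>w0\<close> lie in a common edge, whose projection is in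
    \<open>S\<close> and therefore still has \<open>k\<close> elements.\<close>
  have inj0: "inj_on fst w0"
  proof (rule inj_onI)
    fix p q assume pq: "p \<in> w0" "q \<in> w0" "fst p = fst q"
    have "k \<le> card w0" using card0 k(2) by simp
    then obtain e where e: "e \<in> nsets w0 k" "p \<in> e" "q \<in> e"
      using nsets_pair[OF w0(2) k(1) _ pq(1,2)] by blast
    have "card (fst ` e) = card e" using edge[OF e(1)] S nsetsD e(1) by (metis subsetD)
    then have "inj_on fst e" using eq_card_imp_inj_on nsetsD[OF e(1)] by blast
    then show "p = q" using e pq(3) by (auto dest: inj_onD)
  qed
  show thesis
  proof (rule that[of "fst ` w0"])
    show "fst ` w0 \<in> nsets UNIV (n - 1)" using card0 inj0 w0(2) by (simp add: nsets_def card_image)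
    show "nsets (fst ` w0) k \<subseteq> S" unfolding nsets_image_inj[OF inj0] using edge by blast
    show "nsets (fst ` w0) (k - 1) \<subseteq> s"
      unfolding nsets_image_inj[OF inj0]
    proof
      fix t assume "t \<in> (`) fst ` nsets w0 (k - 1)"
      then obtain u where u: "t = fst ` u" "u \<in> nsets w0 (k - 1)" by blast
      then have "u \<in> nsets w (k - 1)" using nsets_mono[OF w0(1)] by blast
      then obtain j where j: "j \<in> s" "u \<subseteq> parameters n n' j" using ws by blast
      note uD = nsetsD[OF u(2)]
      \<comment> \<open>Below colour \<open>n - 1\<close>, \<open>parameters n n' j\<close> has
        first coordinates in \<open>j\<close> only. Equality of \<open>t\<close> and
        \<open>j\<close> then follows by counting.\<close>
      have "t \<subseteq> j" using u(1) uD j(2) by (fastforce simp: w0_def parameters_def)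
      moreover have "card t = k - 1"
        using u(1) uD card_image[OF inj_on_subset[OF inj0]] by metis
      moreover have "finite j" "card j = k - 1" using s j(1) nsetsD by blast+
      ultimately have "t = j" using card_subset_eq by metis
      then show "t \<in> s" using j(1) by simp
    qed
  qed
qed

text \<open>Colour \<open>v\<close> bijectively with the colours below \<open>n - 1\<close> and add
  the common pairs, which contribute the remaining colours.\<close>

lemma coloured_clique_of_clique:
  assumes k: "2 \<le> k" "k < n" "n \<le> n'"
    and v: "v \<in> nsets UNIV (n - 1)" "nsets v (k - 1) \<subseteq> s" "nsets v k \<subseteq> S"
  obtains w where "w \<in> nsets UNIV (n' - 1)" "nsets w k \<subseteq> coloured_graph n n' k S"
    "\<And>u. u \<in> nsets w (k - 1) \<Longrightarrow> \<exists>j \<in> s. u \<subseteq> parameters n n' j"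
proof -
  note fin = nsetsD[OF v(1)]
  obtain c where c: "bij_betw c v {..<n - 1}"
    using ex_bij_betw_finite_nat[of v] fin by (auto simp: atLeast0LessThan)
  define w0 where "w0 = (\<lambda>i. (i, c i)) ` v"
  define w where "w = w0 \<union> {0} \<times> {n - 1..<n' - 1}"
  have cv: "c ` v = {..<n - 1}" and injc: "inj_on c v" using c by (auto simp: bij_betw_def)
  have cless: "c i < n - 1" if "i \<in> v" for i using cv that by blast
  have injw: "inj_on snd w"
    using injc cless by (fastforce simp: w_def w0_def inj_on_def)
  have "snd ` w = c ` v \<union> {n - 1..<n' - 1}"
    by (force simp: w_def w0_def image_Un image_image)
  also have "\<dots> = {..<n' - 1}" using cv k by auto
  finally have sndw: "snd ` w = {..<n' - 1}" .
  have finw: "finite w" using fin by (simp add: w_def w0_def)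
  have low: "p \<in> w0" if "p \<in> w" "snd p < n - 1" for p
    using that by (auto simp: w_def)
  have inj0: "inj_on fst w0" by (auto simp: w0_def inj_on_def)
  have fst0: "fst ` w0 = v" by (force simp: w0_def)
  show thesis
  proof (rule that[of w])
    show "w \<in> nsets UNIV (n' - 1)"
      using finw card_image[OF injw] sndw by (simp add: nsets_def)
    show "nsets w k \<subseteq> coloured_graph n n' k S"
    proof
      fix e assume e: "e \<in> nsets w k"
      note eD = nsetsD[OF e]
      have "fst ` e \<in> S" if "snd ` e \<subseteq> {..<n - 1}"
      proof -
        have "e \<subseteq> w0" using that eD low by blast
        then have "e \<in> nsets w0 k" using e by (simp add: nsets_def)
        then have "fst ` e \<in> nsets v k" using nsets_image_inj[OF inj0] fst0 by blast
        then show ?thesis using v(3) by blast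
      qed
      moreover have "inj_on snd e" using eD injw inj_on_subset by blast
      moreover have "snd ` e \<subseteq> {..<n' - 1}" using eD sndw by blast
      ultimately show "e \<in> coloured_graph n n' k S"
        using e by (simp add: coloured_graph_def nsets_def)
    qed
    fix u assume u: "u \<in> nsets w (k - 1)"
    note uD = nsetsD[OF u]
    \<comment> \<open>Some elements of \<open>u\<close> may be common pairs, so the first
      coordinates of the rest can number fewer than \<open>k - 1\<close>; they are enlarged to a
      \<open>(k - 1)\<close>-subset \<open>j\<close> of \<open>v\<close>, which belongs to
      \<open>s\<close>.\<close>
    have "card (fst ` (u \<inter> w0)) \<le> card (u \<inter> w0)" using uD by (intro card_image_le) auto
    also have "\<dots> \<le> k - 1" using uD card_mono[of u "u \<inter> w0"] by auto
    finally have "card (fst ` (u \<inter> w0)) \<le> k - 1" .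
    moreover have "fst ` (u \<inter> w0) \<subseteq> v" using fst0 by blast
    moreover have "k - 1 \<le> card v" using fin k by simp
    ultimately obtain j where j: "fst ` (u \<inter> w0) \<subseteq> j" "j \<subseteq> v" "card j = k - 1"
      using exists_subset_between[of "fst ` (u \<inter> w0)" "k - 1" v] fin by blast
    have "finite j" using j(2) fin finite_subset by blast
    then have "j \<in> s" using j(2,3) v(2) by (auto simp: nsets_def)
    moreover have "u \<subseteq> parameters n n' j"
    proof
      fix p assume p: "p \<in> u"
      then consider "p \<in> w0" | "p \<in> {0} \<times> {n - 1..<n' - 1}" using uD by (auto simp: w_def)
      then show "p \<in> parameters n n' j"
      proof cases
        case 1
        then have "fst p \<in> j" "snd p < n - 1" using p j(1) cless by (auto simp: w0_def)
        then show ?thesis by (cases p) (auto simp: parameters_def)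
      qed (auto simp: parameters_def)
    qed
    ultimately show "\<exists>j \<in> s. u \<subseteq> parameters n n' j" by blast
  qed
qed

section \<open>The formula\<close>

text \<open>Variable \<open>0\<close> is the single object variable and \<open>1, ..., q\<close> are
  the parameters, matching the split of variables in \<open>formula_admits\<close> with
  \<open>p = 1\<close>.\<close>

definition star_fm :: "nat \<Rightarrow> nat \<Rightarrow> fm" where
  "star_fm k q = big_conj (nsets {0<..q} (k - 1)) (\<lambda>e. edge_fm (insert 0 e))"

lemma star_fm_simps:
  assumes "0 < k"
  shows "is_formula k (star_fm k q)" and "fv (star_fm k q) \<subseteq> {..<1 + q}"
proof -
  have "card (insert 0 e) = k" "finite e" "fv (edge_fm (insert 0 e)) \<subseteq> {..<1 + q}"
    if "e \<in> nsets {0<..q} (k - 1)" for e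
    using nsetsD[OF that] assms by (auto simp: card_insert_if)
  then show "is_formula k (star_fm k q)" "fv (star_fm k q) \<subseteq> {..<1 + q}"
    unfolding star_fm_def by (simp_all, blast)
qed

lemma sat_star_fm:
  assumes M: "hypergraph k M" and k: "0 < k" and ys: "distinct ys"
  shows "sat M (\<lambda>i. ([x] @ ys) ! i) (star_fm k (length ys)) \<longleftrightarrow>
    (\<forall>u \<in> nsets (set ys) (k - 1). insert x u \<in> edges M)"
proof -
  let ?a = "\<lambda>i. ([x] @ ys) ! i"
  let ?I = "{0<..length ys}"
  \<comment> \<open>In \<open>[x] @ ys\<close> the entries of \<open>ys\<close> are shifted by one
    position.\<close>
  have I: "?I = Suc ` {..<length ys}" by (auto simp: image_iff Suc_le_eq gr0_conv_Suc)
  have inj: "inj_on ?a ?I" unfolding I using ys by (auto simp: inj_on_def nth_eq_iff_index_eq)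
  have im: "?a ` ?I = set ys" unfolding I by (auto simp: image_image set_conv_nth)
  have "sat M ?a (edge_fm (insert 0 e)) \<longleftrightarrow> insert x (?a ` e) \<in> edges M"
    if "e \<in> nsets ?I (k - 1)" for e
  proof -
    have "finite e" "card (insert 0 e) = k" using nsetsD[OF that] k by (auto simp: card_insert_if)
    then show ?thesis using sat_edge_fm[OF M, of "insert 0 e" ?a] by simp
  qed
  then show ?thesis
    unfolding star_fm_def im[symmetric] nsets_image_inj[OF inj] by (simp del: append_Cons)
qed

section \<open>The pattern inside the monster model\<close>

theorem theorem7p7:
  fixes k n n' :: nat and S :: "nat set set"
    and M :: "'a struct" and \<kappa> :: "'c rel"
  assumes "2 \<le> k" and "k < n" and "n \<le> n'"
    and "random_hypergraph k S"
    and "monster_model k (T_clique_free n' k) \<kappa> M"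
  shows "admits k M (nsets UNIV (k - 1)) (Delta UNIV n k S)"
proof -
  have k: "0 < k" "k < n'" "k \<le> n'" "0 < n'" using assms(1-3) by auto
  have S: "S \<subseteq> nsets UNIV k" using assms(4) by (simp add: random_hypergraph_def)
  have mod: "is_model k (T_clique_free n' k) M" using assms(5) by (simp add: monster_model_def)
  note hyp = T_clique_free_hypergraph[OF mod]
  note ext = T_clique_free_extension_property[OF mod k(1,2)]
  let ?G = "coloured_graph n n' k S"
  obtain f :: "nat \<times> nat \<Rightarrow> 'a" where f: "inj f" "range f \<subseteq> univ M"
    "\<And>e. e \<in> nsets UNIV k \<Longrightarrow> f ` e \<in> edges M \<longleftrightarrow> e \<in> ?G"
    using countable_embedding[OF ext k(1,4) coloured_graph_clique_free[OF assms(1) k(3)]] by blast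
  have injf: "inj_on f w" for w using f(1) inj_on_subset by blast
  have f_clique: "nsets (f ` w) k \<subseteq> edges M \<longleftrightarrow> nsets w k \<subseteq> ?G" for w
  proof -
    have "f ` e \<in> edges M \<longleftrightarrow> e \<in> ?G" if "e \<in> nsets w k" for e
      using that f(3) nsets_mono[OF subset_UNIV] by blast
    then show ?thesis unfolding nsets_image_inj[OF injf] by blast
  qed
  let ?V = "parameters n n'"
  \<comment> \<open>The common size of the sets \<open>?V j\<close> for \<open>(k - 1)\<close>-sets
    \<open>j\<close>, by \<open>card_parameters\<close>.\<close>
  define q where "q = (k - 1) * (n - 1) + (n' - 1 - (n - 1))"
  have "\<exists>ys. set ys = f ` ?V j \<and> distinct ys \<and> length ys = q" if "j \<in> nsets UNIV (k - 1)" for j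
  proof -
    note j = nsetsD[OF that]
    obtain ys where ys: "set ys = f ` ?V j" "distinct ys"
      using finite_distinct_list finite_parameters j by (metis finite_imageI)
    have "length ys = card (f ` ?V j)" using ys distinct_card by metis
    also have "\<dots> = q" using j by (simp add: card_image[OF injf] card_parameters q_def)
    finally show ?thesis using ys by blast
  qed
  then obtain a where a: "set (a j) = f ` ?V j" "distinct (a j)" "length (a j) = q"
    if "j \<in> nsets UNIV (k - 1)" for j
    by metis
  have sat: "sat M (\<lambda>i. ([x] @ a j) ! i) (star_fm k q) \<longleftrightarrow>
      (\<forall>u \<in> nsets (?V j) (k - 1). insert x (f ` u) \<in> edges M)"
    if "j \<in> nsets UNIV (k - 1)" for j x
    using sat_star_fm[OF hyp k(1) a(2)[OF that], of x] a(1,3)[OF that]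
    by (simp add: nsets_image_inj[OF injf])
  have admits: "(\<exists>x \<in> univ M. \<forall>j \<in> s. sat M (\<lambda>i. ([x] @ a j) ! i) (star_fm k q)) \<longleftrightarrow>
      s \<in> Delta UNIV n k S" if s: "s \<in> Fpow (nsets UNIV (k - 1))" for s
  proof
    assume "\<exists>x \<in> univ M. \<forall>j \<in> s. sat M (\<lambda>i. ([x] @ a j) ! i) (star_fm k q)"
    then obtain x where x: "x \<in> univ M" "\<forall>j \<in> s. \<forall>u \<in> nsets (?V j) (k - 1). insert x (f ` u) \<in> edges M"
      using sat s unfolding Fpow_def by blast
    show "s \<in> Delta UNIV n k S"
    proof (rule ccontr)
      assume "s \<notin> Delta UNIV n k S"
      then obtain v where "v \<in> nsets UNIV (n - 1)" "nsets v (k - 1) \<subseteq> s" "nsets v k \<subseteq> S"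
        using s unfolding Delta_def by blast
      then obtain w where w: "w \<in> nsets UNIV (n' - 1)" "nsets w k \<subseteq> ?G"
        "\<And>u. u \<in> nsets w (k - 1) \<Longrightarrow> \<exists>j \<in> s. u \<subseteq> ?V j"
        using coloured_clique_of_clique[OF assms(1-3)] by metis
      note wD = nsetsD[OF w(1)]
      have xw: "insert x (f ` u) \<in> edges M" if u: "u \<in> nsets w (k - 1)" for u
        using w(3)[OF u] x(2) nsetsD[OF u] by (auto simp: nsets_def)
      \<comment> \<open>If \<open>x\<close> were \<open>f p\<close> with \<open>p\<close> in
        \<open>w\<close>, choose a \<open>(k - 1)\<close>-subset \<open>u\<close> of
        \<open>w\<close> containing \<open>p\<close>, possible since \<open>k\<close> is at least 2.
        The edge formed by \<open>x\<close> and the image of \<open>u\<close> would have only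
        \<open>k - 1\<close> vertices.\<close>
      have "x \<notin> f ` w"
      proof
        assume "x \<in> f ` w"
        then obtain p where p: "p \<in> w" "x = f p" by blast
        have "card {p} \<le> k - 1" "k - 1 \<le> card w" using wD assms(1-3) by auto
        then obtain u where u: "{p} \<subseteq> u" "u \<subseteq> w" "card u = k - 1"
          using exists_subset_between[of "{p}" "k - 1" w] wD p(1) by blast
        have "finite u" using u(2) wD finite_subset by blast
        then have uw: "u \<in> nsets w (k - 1)" using u(2,3) by (simp add: nsets_def)
        have "card (insert x (f ` u)) = k" using hypergraph_edgeD[OF hyp xw[OF uw]] nsetsD by blast
        moreover have "insert x (f ` u) = f ` u" using u(1) p(2) by auto
        ultimately show False using u(3) k(1) by (simp add: card_image[OF injf])
      qed
      \<comment> \<open>\<open>x\<close> completes the image of \<open>w\<close> to an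
        \<open>n'\<close>-clique of \<open>M\<close>.\<close>
      then have "insert x (f ` w) \<in> nsets (univ M) n'"
        using wD x(1) f(2) k(4) by (auto simp: nsets_def card_image[OF injf])
      moreover have "nsets (insert x (f ` w)) k \<subseteq> edges M"
        unfolding nsets_insert_subset_iff[OF \<open>x \<notin> f ` w\<close> k(1)] nsets_image_inj[OF injf]
        using w(2) xw f_clique[of w, unfolded nsets_image_inj[OF injf]] by blast
      ultimately show False
        using T_clique_free_clique_free[OF mod] unfolding clique_free_def by blast
    qed
  next
    assume sD: "s \<in> Delta UNIV n k S"
    have fin: "finite s" "s \<subseteq> nsets UNIV (k - 1)" using s by (auto simp: Fpow_def)
    \<comment> \<open>\<open>U\<close> is the least link that realises the instances in
      \<open>s\<close>: all \<open>(k - 1)\<close>-subsets of the sets \<open>?V j\<close>, and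
      nothing else.\<close>
    define U where "U = (\<Union>j \<in> s. nsets (?V j) (k - 1))"
    let ?A = "f ` (\<Union>j \<in> s. ?V j)"
    have finV: "finite (?V j)" if "j \<in> s" for j using that fin(2) nsetsD finite_parameters by blast
    have mem: "f ` u \<in> (`) f ` U \<longleftrightarrow> u \<in> U" for u using f(1) by (auto simp: inj_image_eq_iff)
    have sub: "(`) f ` U \<subseteq> nsets ?A (k - 1)"
      unfolding nsets_image_inj[OF injf] by (rule image_mono) (auto simp: U_def nsets_def)
    obtain x where x: "x \<in> univ M"
      "\<And>e. e \<in> nsets ?A (k - 1) \<Longrightarrow> insert x e \<in> edges M \<longleftrightarrow> e \<in> (`) f ` U"
    proof (rule extension_propertyD[OF ext _ _ sub])
      show "finite ?A" using fin(1) finV by blast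
      show "?A \<subseteq> univ M" using f(2) by blast
      \<comment> \<open>An obstruction to this link pulls back along \<open>f\<close> to an
        \<open>(n' - 1)\<close>-clique of the coloured graph, hence yields a clique of
        \<open>S\<close> showing that \<open>s\<close> is not in \<open>Delta\<close>.\<close>
      fix w' assume w': "w' \<in> nsets ?A (n' - 1)" "nsets w' k \<subseteq> edges M" "nsets w' (k - 1) \<subseteq> (`) f ` U"
      obtain w where w: "w' = f ` w" "w \<in> nsets (\<Union>j \<in> s. ?V j) (n' - 1)"
        using w'(1) unfolding nsets_image_inj[OF injf] by blast
      have "w \<in> nsets UNIV (n' - 1)" using w(2) by (simp add: nsets_def)
      moreover have "nsets w k \<subseteq> ?G" using w'(2) f_clique w(1) by blast
      moreover have "\<exists>j \<in> s. u \<subseteq> ?V j" if "u \<in> nsets w (k - 1)" for u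
      proof -
        have "f ` u \<in> nsets w' (k - 1)"
          unfolding w(1) nsets_image_inj[OF injf] using that by (rule imageI)
        then have "u \<in> U" using w'(3) mem by (metis subsetD)
        then show ?thesis unfolding U_def using nsetsD by blast
      qed
      ultimately obtain v where "v \<in> nsets UNIV (n - 1)" "nsets v (k - 1) \<subseteq> s" "nsets v k \<subseteq> S"
        using clique_of_coloured_clique[OF assms(1-3) S fin(2)] by metis
      then show False using sD unfolding Delta_def by blast
    qed blast
    have "insert x (f ` u) \<in> edges M" if "j \<in> s" "u \<in> nsets (?V j) (k - 1)" for j u
    proof -
      have "f ` u \<in> (`) f ` U" unfolding U_def using that by blast
      then show ?thesis using x(2) sub by (metis subsetD)
    qed
    then show "\<exists>x \<in> univ M. \<forall>j \<in> s. sat M (\<lambda>i. ([x] @ a j) ! i) (star_fm k q)"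
      using x(1) sat fin(2) by blast
  qed
  have length_1: "(\<exists>b. length b = 1 \<and> set b \<subseteq> univ M \<and> Q b) \<longleftrightarrow> (\<exists>x \<in> univ M. Q [x])" for Q
    by (auto simp: length_Suc_conv)
  have "formula_admits k M (star_fm k q) 1 q (nsets UNIV (k - 1)) (Delta UNIV n k S)"
    unfolding formula_admits_def
  proof (intro conjI exI[of _ a] ballI)
    show "is_formula k (star_fm k q)" "fv (star_fm k q) \<subseteq> {..<1 + q}"
      using star_fm_simps[OF k(1)] .
    show "length (a j) = q" "set (a j) \<subseteq> univ M" if "j \<in> nsets UNIV (k - 1)" for j
      using a[OF that] f(2) by auto
    show "(\<exists>b. length b = 1 \<and> set b \<subseteq> univ M \<and> (\<forall>j\<in>s. sat M (\<lambda>i. (b @ a j) ! i) (star_fm k q)))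
        = (s \<in> Delta UNIV n k S)" if "s \<in> Fpow (nsets UNIV (k - 1))" for s
      unfolding length_1 using admits[OF that] .
  qed
  then show ?thesis unfolding admits_def by blast
qed

end
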